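(* Let $H$ be a space of real functions on $\mathbb R$ closed under shifts, equipped with the cylindrical $\sigma$-field, and let $\mathcal I$ be the set of compact non-degenerate intervals of $\mathbb R$. If $L:H\times\mathcal I\to\mathbb R\cup\{\infty\}$ is an intrinsic location functional, then for any $T>0$, $$L_T(f,a):=L(f,[a,a+T]),\qquad f\in H,\ a\in\mathbb R,$$ is a local intrinsic location functional with related length $T$. Conversely, if $T>0$ and $L_T:H\times\mathbb R\to\mathbb R\cup\{\infty\}$ is a local intrinsic location functional with related length $T$, then there exists a pre-intrinsic location functional $L:H\times\mathcal I\to\mathbb R\cup\{\infty\}$ such that $L_T(f,a)=L(f,[a,a+T])$ for all $f\in H$ and $a\in\mathbb R$.
   Context: For $f\in H$, $c\in\mathbb R$: $\theta_cf(x)=f(x+c)$; closed under shifts means $\theta_cf\in H$. $\mathbb R\cup\{\infty\}$ carries the $\sigma$-field generated by the Borel sets of $\mathbb R$ and $\{\infty\}$; $\infty+c=\infty$. Intrinsic location functional: a map $L:H\times\mathcal I\to\mathbb R\cup\{\infty\}$ such that (1) for every $I\in\mathcal I$, $L(\cdot,I)$ is measurable; (2) $L(f,I)\in I\cup\{\infty\}$ for all $f\in H$, $I\in\mathcal I$; (3) $L(f,I)=L(\theta_cf,I-c)+c$ for all $f\in H$, $I\in\mathcal I$, $c\in\mathbb R$; (4) for $f\in H$ and $I_2\subseteq I_1$ in $\mathcal I$, if $L(f,I_1)\in I_2$ then $L(f,I_2)=L(f,I_1)$; (5) for $f\in H$ and $I_2\subseteq I_1$ in $\mathcal I$, if $L(f,I_2)\ne\infty$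 then $L(f,I_1)\neq\infty$. A pre-intrinsic location functional is a map $L:H\times\mathcal I\to\mathbb R\cup\{\infty\}$ satisfying (2)–(5) but not necessarily the measurability condition (1). Local intrinsic location functional with related length $T>0$: a map $L_T:H\times\mathbb R\to\mathbb R\cup\{\infty\}$ such that (1) for every $a\in\mathbb R$, $L_T(\cdot,a):H\to\mathbb R\cup\{\infty\}$ is measurable; (2) $L_T(f,a)\in[a,a+T]\cup\{\infty\}$ for all $f\in H$, $a\in\mathbb R$; (3) $L_T(f,a)=L_T(\theta_cf,a-c)+c$ for all $f\in H$, $a,c\in\mathbb R$; (4) for all $f\in H$, $a,b\in\mathbb R$, $L_T(f,a)\in[b,b+T]$ implies that either $L_T(f,b)=L_T(f,a)$ or $L_T(f,b)\in[b,b+T]\setminus[a,a+T]$. *)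

theory Defs
  imports "HOL-Analysis.Analysis"
begin

definition shift :: "real \<Rightarrow> (real \<Rightarrow> real) \<Rightarrow> real \<Rightarrow> real" where
  "shift c f = (\<lambda>x. f (x + c))"

definition closed_under_shifts :: "(real \<Rightarrow> real) set \<Rightarrow> bool" where
  "closed_under_shifts H \<longleftrightarrow> (\<forall>f\<in>H. \<forall>c. shift c f \<in> H)"

definition cylindrical :: "(real \<Rightarrow> real) set \<Rightarrow> (real \<Rightarrow> real) measure" where
  "cylindrical H = restrict_space (\<Pi>\<^sub>M t\<in>(UNIV::real set). borel) H"

text \<open>The set \<open>\<real> \<union> {\<infinity>}\<close> is represented inside \<^typ>\<open>ereal\<close>, whose further element \<open>-\<infinity>\<close> is
  excluded from the values of a location functional by the range conditions below.\<close>

definition real_infty :: "ereal measure" where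
  "real_infty = sigma (range ereal \<union> {\<infinity>}) ({ereal ` B | B. B \<in> sets borel} \<union> {{\<infinity>}})"

definition compact_intervals :: "real set set" where
  "compact_intervals = {{a..b} | a b. a < b}"

text \<open>The functionals below are total functions, but they are constrained only on \<^term>\<open>H\<close> and
  \<^term>\<open>compact_intervals\<close>. The image of \<open>\<lambda>x. x - c\<close> on \<open>I\<close> is the translate \<open>I - c\<close>.\<close>

definition pre_intrinsic_location_functional ::
    "(real \<Rightarrow> real) set \<Rightarrow> ((real \<Rightarrow> real) \<Rightarrow> real set \<Rightarrow> ereal) \<Rightarrow> bool" where
  "pre_intrinsic_location_functional H L \<longleftrightarrow>
     (\<forall>f\<in>H. \<forall>I\<in>compact_intervals. L f I \<in> ereal ` I \<union> {\<infinity>}) \<and>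
     (\<forall>f\<in>H. \<forall>I\<in>compact_intervals. \<forall>c.
        L f I = L (shift c f) ((\<lambda>x. x - c) ` I) + ereal c) \<and>
     (\<forall>f\<in>H. \<forall>I\<^sub>1\<in>compact_intervals. \<forall>I\<^sub>2\<in>compact_intervals.
        I\<^sub>2 \<subseteq> I\<^sub>1 \<longrightarrow> L f I\<^sub>1 \<in> ereal ` I\<^sub>2 \<longrightarrow> L f I\<^sub>2 = L f I\<^sub>1) \<and>
     (\<forall>f\<in>H. \<forall>I\<^sub>1\<in>compact_intervals. \<forall>I\<^sub>2\<in>compact_intervals.
        I\<^sub>2 \<subseteq> I\<^sub>1 \<longrightarrow> L f I\<^sub>2 \<noteq> \<infinity> \<longrightarrow> L f I\<^sub>1 \<noteq> \<infinity>)"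

definition intrinsic_location_functional ::
    "(real \<Rightarrow> real) set \<Rightarrow> ((real \<Rightarrow> real) \<Rightarrow> real set \<Rightarrow> ereal) \<Rightarrow> bool" where
  "intrinsic_location_functional H L \<longleftrightarrow>
     (\<forall>I\<in>compact_intervals. (\<lambda>f. L f I) \<in> cylindrical H \<rightarrow>\<^sub>M real_infty) \<and>
     pre_intrinsic_location_functional H L"

definition local_intrinsic_location_functional ::
    "(real \<Rightarrow> real) set \<Rightarrow> real \<Rightarrow> ((real \<Rightarrow> real) \<Rightarrow> real \<Rightarrow> ereal) \<Rightarrow> bool" where
  "local_intrinsic_location_functional H T L\<^sub>T \<longleftrightarrow>
     0 < T \<and>
     (\<forall>a. (\<lambda>f. L\<^sub>T f a) \<in> cylindrical H \<rightarrow>\<^sub>M real_infty) \<and>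
     (\<forall>f\<in>H. \<forall>a. L\<^sub>T f a \<in> ereal ` {a..a + T} \<union> {\<infinity>}) \<and>
     (\<forall>f\<in>H. \<forall>a c. L\<^sub>T f a = L\<^sub>T (shift c f) (a - c) + ereal c) \<and>
     (\<forall>f\<in>H. \<forall>a b. L\<^sub>T f a \<in> ereal ` {b..b + T} \<longrightarrow>
        L\<^sub>T f b = L\<^sub>T f a \<or> L\<^sub>T f b \<in> ereal ` ({b..b + T} - {a..a + T}))"

end

theory Submission
  imports Defs
begin

text \<open>For the first claim, compare the windows \<open>[a, a + T]\<close> and \<open>[b, b + T]\<close> with their union, which
  is an interval as soon as they meet.

  For the converse, fix \<open>f\<close> and write \<open>l a\<close> for \<open>L\<^sub>T f a\<close>. The function \<open>l\<close> is nondecreasing where it is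
  finite, and it moves from one location to another only if the old one leaves the window on the left
  or the new one enters it on the right. On an interval \<open>I\<close> of length at most \<open>T\<close>, all windows
  containing \<open>I\<close> whose location lies in \<open>I\<close> agree on it, and this is the value of \<open>L\<close>. On a longer
  interval \<open>[u, v]\<close>, call a window \<open>[a, a + T] \<subseteq> [u, v]\<close> persistent if \<open>l a\<close> stays the location until it
  leaves on the left or the window reaches \<open>v\<close>. There is a leftmost persistent window, and \<open>L\<close> is its
  location. Since this recipe uses only \<open>l\<close> and the order of the line, it commutes with shifts.\<close>

section \<open>Windows of length \<open>T\<close> sliding along the line\<close>

text \<open>\<open>F\<close> holds the left ends of the windows whose location is finite, so that
  \<open>l\<close> can be real-valued. The assumption \<open>exchange\<close> is the compatibility
  axiom of a local functional, written with inequalities.\<close>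

locale sliding_window =
  fixes T :: real and F :: "real set" and l :: "real \<Rightarrow> real"
  assumes T_pos: "0 < T"
    and in_window: "a \<in> F \<Longrightarrow> a \<le> l a \<and> l a \<le> a + T"
    and exchange: "a \<in> F \<Longrightarrow> b \<le> l a \<Longrightarrow> l a \<le> b + T \<Longrightarrow>
      b \<in> F \<and> (l b = l a \<or> l b < a \<or> a + T < l b)"

definition persistent :: "real \<Rightarrow> real set \<Rightarrow> (real \<Rightarrow> real) \<Rightarrow> real \<Rightarrow> real \<Rightarrow> real set" where
  "persistent T F l u v =
     {a \<in> F. u \<le> a \<and> a \<le> v - T \<and> (\<forall>b. a \<le> b \<longrightarrow> b \<le> v - T \<longrightarrow> b \<le> l a \<longrightarrow> l b = l a)}"

text \<open>In the first branch the window at \<open>a\<close> covers \<open>[u, v]\<close>; in the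
  second the windows lie inside \<open>[u, v]\<close>.\<close>

definition located :: "real \<Rightarrow> real set \<Rightarrow> (real \<Rightarrow> real) \<Rightarrow> real \<Rightarrow> real \<Rightarrow> real \<Rightarrow> bool" where
  "located T F l u v x \<longleftrightarrow>
     (if v - u \<le> T then \<exists>a\<in>F. v - T \<le> a \<and> a \<le> u \<and> l a = x \<and> u \<le> x \<and> x \<le> v
      else \<exists>s \<in> persistent T F l u v. (\<forall>a \<in> persistent T F l u v. s \<le> a) \<and> l s = x)"

definition location :: "real \<Rightarrow> real set \<Rightarrow> (real \<Rightarrow> real) \<Rightarrow> real \<Rightarrow> real \<Rightarrow> ereal" where
  "location T F l u v =
     (if \<exists>x. located T F l u v x then ereal (THE x. located T F l u v x) else \<infinity>)"

context sliding_window
begin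

text \<open>If \<open>l b < l a\<close>, each of the two windows would contain both locations, and
  \<open>exchange\<close> would force these to be equal.\<close>

lemma window_mono:
  assumes "a \<in> F" "b \<in> F" "a \<le> b"
  shows "l a \<le> l b"
proof (rule ccontr)
  assume "\<not> l a \<le> l b"
  then show False
    using in_window[OF assms(1)] in_window[OF assms(2)] exchange[OF assms(1), of b] assms by auto
qed

text \<open>As long as \<open>b \<le> l a\<close>, the window moved right to \<open>b\<close> still
  contains \<open>l a\<close>, and no point left of \<open>a\<close> can become its location. So a
  new location must enter on the right.\<close>

lemma window_jump:
  assumes "a \<in> F" "a \<le> b" "b \<le> l a"
  shows "b \<in> F" and "l b = l a \<or> a + T < l b"
proof -
  have *: "b \<in> F \<and> (l b = l a \<or> l b < a \<or> a + T < l b)"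
    using exchange[OF assms(1), of b] in_window[OF assms(1)] assms by linarith
  then show "b \<in> F" ..
  with * show "l b = l a \<or> a + T < l b"
    using in_window[of b] assms by linarith
qed

section \<open>The leftmost persistent window\<close>

text \<open>The window at \<open>v - T\<close> has no room to move. If it has no location, take a
  start in \<open>A\<close> within \<open>T\<close> of the supremum: a change would create a
  location beyond the supremum that is itself a start in \<open>A\<close>.\<close>

lemma persistent_nonempty:
  assumes "b \<in> F" "u \<le> b" "b \<le> v - T"
  shows "persistent T F l u v \<noteq> {}"
proof (cases "v - T \<in> F")
  case True
  then have "v - T \<in> persistent T F l u v"
    using assms by (auto simp: persistent_def)
  then show ?thesis by blast
next
  case False
  define A where "A = {a \<in> F. u \<le> a \<and> a \<le> v - T}"
  have bdd: "bdd_above A" and ne: "A \<noteq> {}"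
    using assms by (auto simp: A_def intro: bdd_aboveI[where M = "v - T"])
  obtain a where a: "a \<in> A" "Sup A - T < a"
    using less_cSup_iff[OF ne bdd, of "Sup A - T"] T_pos by auto
  have "l c = l a" if c: "a \<le> c" "c \<le> v - T" "c \<le> l a" for c
  proof (rule ccontr)
    assume "l c \<noteq> l a"
    with window_jump[of a c] a c have cF: "c \<in> F" and far: "a + T < l c"
      by (auto simp: A_def)
    have lc: "c \<le> l c" using in_window[OF cF] by blast
    \<comment> \<open>Otherwise the window at \<open>v - T\<close> would contain \<open>l c\<close>
      and so have a location.\<close>
    have "l c \<le> v - T"
      using window_jump(1)[OF cF, of "v - T"] c False by linarith
    moreover have "l c \<in> F"
      using window_jump(1)[OF cF lc] by simp
    ultimately have "l c \<in> A"
      using a(1) c lc by (auto simp: A_def)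
    then show False
      using cSup_upper[OF _ bdd] a(2) far by fastforce
  qed
  then have "a \<in> persistent T F l u v"
    using a(1) unfolding persistent_def A_def by blast
  then show ?thesis by blast
qed

text \<open>The candidate is the infimum of the starts; the point is that it is attained.\<close>

lemma persistent_has_least:
  assumes "persistent T F l u v \<noteq> {}"
  obtains s where "s \<in> persistent T F l u v" "\<And>a. a \<in> persistent T F l u v \<Longrightarrow> s \<le> a"
proof -
  define D where "D = persistent T F l u v"
  define s where "s = Inf D"
  have bdd: "bdd_below D" and ne: "D \<noteq> {}"
    using assms by (auto simp: D_def persistent_def intro: bdd_belowI[where m = u])
  have low: "s \<le> a" if "a \<in> D" for a
    unfolding s_def by (rule cInf_lower[OF that bdd])
  have near: "\<exists>a\<in>D. a < t" if "s < t" for t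
    using cInf_less_iff[OF ne bdd, of t] that by (simp add: s_def)
  have DD: "d \<in> F" "u \<le> d" "d \<le> v - T" "\<And>b. d \<le> b \<Longrightarrow> b \<le> v - T \<Longrightarrow> b \<le> l d \<Longrightarrow> l b = l d"
    if "d \<in> D" for d
    using that unfolding D_def persistent_def by blast+
  have us: "u \<le> s"
    unfolding s_def using DD(2) by (intro cInf_greatest[OF ne])
  have sv: "s \<le> v - T"
    using ne low DD(3) by fastforce
  have "s \<in> D"
  proof (rule ccontr)
    assume sD: "s \<notin> D"
    text \<open>Windows of \<open>D\<close> close to \<open>s\<close> share one location, which is beyond \<open>s + T\<close>: but then it lies
      outside those windows that are closest to \<open>s\<close>.\<close>
    have "\<exists>x t. s + T < x \<and> s < t \<and> (\<forall>d\<in>D. d < t \<longrightarrow> l d = x)"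
    proof (cases "s \<in> F")
      case True
      \<comment> \<open>Persistence fails at \<open>s\<close>, so the location has changed at some
        \<open>a\<close>. A window of \<open>D\<close> starting before \<open>a\<close> has its
        location at or right of \<open>l s\<close>, hence not left of \<open>a\<close>, and keeps it
        up to \<open>a\<close>.\<close>
      then obtain a where a: "s \<le> a" "a \<le> v - T" "a \<le> l s" "l a \<noteq> l s"
        using sD us sv unfolding D_def persistent_def by blast
      have "s < a" using a by (cases "a = s") auto
      moreover have "s + T < l a"
        using window_jump(2)[OF True a(1,3)] a(4) by simp
      moreover have "l d = l a" if "d \<in> D" "d < a" for d
        using DD(4)[OF that(1), of a] window_mono[OF True DD(1)[OF that(1)] low[OF that(1)]] a that
        by linarith
      ultimately show ?thesis by blast
    next
      case False
      \<comment> \<open>A start below \<open>s + T\<close> lies left of every \<open>l d\<close>, so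
        each earlier window of \<open>D\<close> still has its location there.\<close>
      obtain e where e: "e \<in> D" "e < s + T"
        using near[of "s + T"] T_pos by auto
      \<comment> \<open>Otherwise the window at \<open>s\<close> would contain \<open>l d\<close>,
        and \<open>s\<close> would be in \<open>F\<close>.\<close>
      have far: "s + T < l d" if "d \<in> D" for d
        using exchange[OF DD(1)[OF that], of s] in_window[OF DD(1)[OF that]] low[OF that] False
        by fastforce
      have "s < e"
        using low[OF e(1)] sD e(1) by (cases "s = e") auto
      moreover have "l d = l e" if "d \<in> D" "d < e" for d
        using DD(4)[OF that(1), of e] DD(3)[OF e(1)] far[OF that(1)] e that by linarith
      ultimately show ?thesis
        using far[OF e(1)] by blast
    qed
    then obtain x t where x: "s + T < x" "s < t" "\<And>d. d \<in> D \<Longrightarrow> d < t \<Longrightarrow> l d = x"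
      by blast
    obtain d where d: "d \<in> D" "d < min t (x - T)"
      using near[of "min t (x - T)"] x by auto
    then show False
      using in_window[OF DD(1)[OF d(1)]] x(3)[OF d(1)] by auto
  qed
  then show thesis
    by (intro that[of s]) (use low in \<open>simp_all add: D_def\<close>)
qed

text \<open>Right of \<open>s\<close> this is persistence. A window at \<open>a\<close> left of
  \<open>s\<close> is not persistent, so a location beyond \<open>a + T\<close> appears at some
  \<open>b\<close>, which monotonicity puts right of \<open>s\<close>. Hence \<open>s\<close> lies
  between \<open>a\<close> and \<open>l a\<close>, and a jump by then would put \<open>l s\<close>
  beyond \<open>a + T\<close>.\<close>

lemma least_persistent_location:
  assumes s: "s \<in> persistent T F l u v" "\<And>a. a \<in> persistent T F l u v \<Longrightarrow> s \<le> a"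
    and a: "u \<le> a" "l s - T \<le> a" "a \<le> l s" "a \<le> v - T"
  shows "a \<in> F" and "l a = l s"
proof -
  have sF: "s \<in> F" and sD: "\<And>b. s \<le> b \<Longrightarrow> b \<le> v - T \<Longrightarrow> b \<le> l s \<Longrightarrow> l b = l s"
    using s(1) unfolding persistent_def by blast+
  show aF: "a \<in> F"
    using exchange[OF sF, of a] a by linarith
  show "l a = l s"
  proof (cases "s \<le> a")
    case True
    then show ?thesis using sD a by blast
  next
    case False
    then have "a \<notin> persistent T F l u v" using s(2) by force
    then obtain b where b: "a \<le> b" "b \<le> v - T" "b \<le> l a" "l b \<noteq> l a"
      using aF a unfolding persistent_def by blast
    have bF: "b \<in> F" and "a + T < l b"
      using window_jump[OF aF b(1,3)] b(4) by auto
    then have "s < b"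
      using window_mono[OF bF sF] a(2) by force
    then show ?thesis
      using window_jump(2)[OF aF, of s] False b a by linarith
  qed
qed

section \<open>The location on an interval\<close>

lemma located_in_interval:
  assumes "located T F l u v x"
  shows "u \<le> x" "x \<le> v" "\<exists>a\<in>F. l a = x"
proof -
  have "u \<le> x \<and> x \<le> v \<and> (\<exists>a\<in>F. l a = x)"
  proof (cases "v - u \<le> T")
    case True
    then show ?thesis using assms by (auto simp: located_def)
  next
    case False
    then obtain s where "s \<in> F" "u \<le> s" "s \<le> v - T" "l s = x"
      using assms by (auto simp: located_def persistent_def)
    then show ?thesis using in_window[of s] by auto
  qed
  then show "u \<le> x" "x \<le> v" "\<exists>a\<in>F. l a = x" by auto
qed

text \<open>On a short interval both windows contain both locations, and \<open>exchange\<close>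
  makes these equal. On a long one, a least element is unique.\<close>

lemma located_unique:
  assumes "located T F l u v x" "located T F l u v y"
  shows "x = y"
proof (cases "v - u \<le> T")
  case True
  obtain a where a: "a \<in> F" "v - T \<le> a" "a \<le> u" "l a = x" "u \<le> x" "x \<le> v"
    using assms(1) True by (auto simp: located_def)
  obtain b where b: "b \<in> F" "v - T \<le> b" "b \<le> u" "l b = y" "u \<le> y" "y \<le> v"
    using assms(2) True by (auto simp: located_def)
  show ?thesis
    using exchange[OF a(1), of b] a b by auto
next
  case False
  then show ?thesis
    using assms by (force simp: located_def intro: antisym)
qed

lemma located_exists:
  assumes "u < v" "a \<in> F" "u \<le> l a" "l a \<le> v"
  shows "\<exists>x. located T F l u v x"
proof (cases "v - u \<le> T")
  case True
  have "\<exists>b\<in>F. v - T \<le> b \<and> b \<le> u \<and> u \<le> l b \<and> l b \<le> v"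
  proof -
    consider "v - T \<le> a" "a \<le> u" | "u < a" | "a < v - T" by linarith
    then show ?thesis
    proof cases
      case 1
      then show ?thesis using assms by blast
    next
      \<comment> \<open>Sliding to \<open>u\<close> keeps \<open>l a\<close> in the window, and by
        monotonicity the new location is at most \<open>l a\<close>, hence inside the interval. The
        third case is the mirror image.\<close>
      case 2
      have "u \<in> F" using exchange[OF assms(2), of u] assms True by linarith
      then show ?thesis
        using window_mono[of u a] in_window[of u] assms 2 True by (intro bexI[of _ u]) auto
    next
      case 3
      have "v - T \<in> F" using exchange[OF assms(2), of "v - T"] assms True by linarith
      then show ?thesis
        using window_mono[of a "v - T"] in_window[of "v - T"] assms 3 True
        by (intro bexI[of _ "v - T"]) auto
    qed
  qed
  then show ?thesis using True by (auto simp: located_def)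
next
  case False
  \<comment> \<open>The leftmost window inside \<open>[u, v]\<close> that contains
    \<open>l a\<close>.\<close>
  define b where "b = max u (l a - T)"
  have "b \<in> F"
    using exchange[OF assms(2), of b] assms T_pos by (auto simp: b_def)
  moreover have "u \<le> b" "b \<le> v - T"
    using assms False by (auto simp: b_def)
  ultimately have "persistent T F l u v \<noteq> {}"
    by (rule persistent_nonempty)
  then obtain s where "s \<in> persistent T F l u v" "\<And>a. a \<in> persistent T F l u v \<Longrightarrow> s \<le> a"
    using persistent_has_least[of u v] by blast
  then show ?thesis using False by (auto simp: located_def)
qed

text \<open>If \<open>[u, v]\<close> is short, the same window serves. Otherwise every window inside
  \<open>[u, v]\<close> that contains \<open>x\<close> has location \<open>x\<close>, and suitable
  ones are chosen among these.\<close>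

lemma located_subinterval:
  assumes "u \<le> u'" "v' \<le> v" "u' < v'" "located T F l u v x" "u' \<le> x" "x \<le> v'"
  shows "located T F l u' v' x"
proof (cases "v - u \<le> T")
  case True
  then obtain a where "a \<in> F" "v - T \<le> a" "a \<le> u" "l a = x"
    using assms(4) by (auto simp: located_def)
  then show ?thesis
    using True assms by (auto simp: located_def intro!: bexI[of _ a])
next
  case False
  then obtain s where s: "s \<in> persistent T F l u v" "\<And>a. a \<in> persistent T F l u v \<Longrightarrow> s \<le> a"
    and x: "l s = x"
    using assms(4) by (auto simp: located_def)
  note near = least_persistent_location[OF s, unfolded x]
  show ?thesis
  proof (cases "v' - u' \<le> T")
    case True
    \<comment> \<open>A window inside \<open>[u, v]\<close> that covers
      \<open>[u', v']\<close>.\<close>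
    define a where "a = max u (v' - T)"
    have "a \<in> F" "l a = x"
      using near[of a] assms True False by (auto simp: a_def)
    moreover have "v' - T \<le> a" "a \<le> u'"
      using assms True by (auto simp: a_def)
    ultimately show ?thesis
      using True assms by (auto simp: located_def)
  next
    case False
    \<comment> \<open>The leftmost window inside \<open>[u', v']\<close> that contains
      \<open>x\<close>.\<close>
    define a where "a = max u' (x - T)"
    have a: "u' \<le> a" "x - T \<le> a" "a \<le> x" "a \<le> v' - T"
      using assms T_pos False by (auto simp: a_def)
    have aF: "a \<in> F" "l a = x"
      using near[of a] a assms by auto
    have aD: "a \<in> persistent T F l u' v'"
      unfolding persistent_def
    proof (intro CollectI conjI allI impI)
      fix b assume "a \<le> b" "b \<le> v' - T" "b \<le> l a"
      then show "l b = l a"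
        using near(2)[of b] a aF assms by simp
    qed (use a aF in auto)
    then obtain s' where s': "s' \<in> persistent T F l u' v'"
        "\<And>a. a \<in> persistent T F l u' v' \<Longrightarrow> s' \<le> a"
      using persistent_has_least[of u' v'] by blast
    have s'F: "s' \<in> F" "u' \<le> s'" "s' \<le> v' - T"
      and s'D: "\<And>b. s' \<le> b \<Longrightarrow> b \<le> v' - T \<Longrightarrow> b \<le> l s' \<Longrightarrow> l b = l s'"
      using s'(1) unfolding persistent_def by blast+
    \<comment> \<open>Otherwise \<open>l s'\<close> lies left of \<open>x\<close> and drops out
      before the window reaches \<open>a\<close>, so \<open>s'\<close> is persistent in
      \<open>[u, v]\<close> too. Then \<open>s \<le> s'\<close>, against monotonicity.\<close>
    have "l s' = x"
    proof (rule ccontr)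
      assume ne: "l s' \<noteq> x"
      have lt: "l s' < x"
        using window_mono[OF s'F(1) aF(1) s'(2)[OF aD]] aF ne by simp
      have "l s' < a"
        using s'D[of a] s'(2)[OF aD] a aF ne by force
      then have "s' \<in> persistent T F l u v"
        using s'F a assms unfolding persistent_def by (auto intro!: s'D)
      then have "s \<le> s'" by (rule s(2))
      moreover have "s \<in> F" using s(1) by (simp add: persistent_def)
      ultimately show False
        using window_mono[of s s'] s'F(1) x lt by simp
    qed
    then show ?thesis
      using s' False by (auto simp: located_def)
  qed
qed

lemma location_eq_ereal_iff: "location T F l u v = ereal x \<longleftrightarrow> located T F l u v x"
proof (cases "\<exists>y. located T F l u v y")
  case True
  then obtain y where y: "located T F l u v y" ..
  moreover from y have "(THE y. located T F l u v y) = y"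
    using located_unique by blast
  ultimately have "location T F l u v = ereal y"
    by (auto simp: location_def)
  then show ?thesis
    using y located_unique by auto
qed (auto simp: location_def)

text \<open>Length exactly \<open>T\<close> falls under the short case, whose bounds force the
  window to start at \<open>a\<close>.\<close>

lemma location_window: "location T F l a (a + T) = (if a \<in> F then ereal (l a) else \<infinity>)"
proof (cases "a \<in> F")
  case True
  then show ?thesis
    using in_window[OF True] by (auto simp: location_eq_ereal_iff located_def intro!: bexI[of _ a])
next
  case False
  then have "\<not> located T F l a (a + T) x" for x
    by (auto simp: located_def dest: antisym)
  then show ?thesis
    using False by (simp add: location_def)
qed

end

section \<open>Equivariance under shifts\<close>

lemma location_neq_infinity_iff: "location T F l u v \<noteq> \<infinity> \<longleftrightarrow> (\<exists>x. located T F l u v x)"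
  by (simp add: location_def)

text \<open>\<open>l\<close> and \<open>l'\<close> are related only on \<open>F\<close>, so the
  windows met on the way must be shown to have locations; \<open>window_jump\<close> supplies
  this.\<close>

lemma persistent_shift:
  assumes F: "\<And>a. a \<in> F \<longleftrightarrow> a - c \<in> F'" and l: "\<And>a. a \<in> F \<Longrightarrow> l a = l' (a - c) + c"
    and w: "sliding_window T F l"
  shows "a \<in> persistent T F l u v \<longleftrightarrow> a - c \<in> persistent T F' l' (u - c) (v - c)"
proof -
  interpret sliding_window T F l by fact
  have "(\<forall>b. a \<le> b \<longrightarrow> b \<le> v - T \<longrightarrow> b \<le> l a \<longrightarrow> l b = l a) \<longleftrightarrow>
        (\<forall>b. a - c \<le> b \<longrightarrow> b \<le> v - c - T \<longrightarrow> b \<le> l' (a - c) \<longrightarrow> l' b = l' (a - c))"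
    (is "?P \<longleftrightarrow> ?Q") if a: "a \<in> F"
  proof
    assume P: ?P
    show ?Q
    proof (intro allI impI)
      fix b
      assume b: "a - c \<le> b" "b \<le> v - c - T" "b \<le> l' (a - c)"
      then have "l (b + c) = l a" "b + c \<in> F"
        using P l[OF a] window_jump(1)[OF a, of "b + c"] by auto
      then show "l' b = l' (a - c)"
        using l[of "b + c"] l[OF a] by simp
    qed
  next
    assume Q: ?Q
    show ?P
    proof (intro allI impI)
      fix b
      assume b: "a \<le> b" "b \<le> v - T" "b \<le> l a"
      then show "l b = l a"
        using Q[rule_format, of "b - c"] l[OF a] l[OF window_jump(1)[OF a b(1,3)]] by simp
    qed
  qed
  then show ?thesis
    unfolding persistent_def using F by auto
qed

lemma located_shift:
  assumes F: "\<And>a. a \<in> F \<longleftrightarrow> a - c \<in> F'" and l: "\<And>a. a \<in> F \<Longrightarrow> l a = l' (a - c) + c"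
    and w: "sliding_window T F l"
  shows "located T F l u v x \<longleftrightarrow> located T F' l' (u - c) (v - c) (x - c)"
proof -
  \<comment> \<open>Quantifiers are reindexed along the bijection \<open>a - c\<close> of the
    line.\<close>
  have all: "(\<forall>a. P a) \<longleftrightarrow> (\<forall>a. P (a - c))" for P :: "real \<Rightarrow> bool"
    by (metis add_diff_cancel_right')
  have ex: "(\<exists>a. P a) \<longleftrightarrow> (\<exists>a. P (a - c))" for P :: "real \<Rightarrow> bool"
    by (metis add_diff_cancel_right')
  have val: "l a = x \<longleftrightarrow> l' (a - c) = x - c" if "a \<in> F" for a
    using l[OF that] by auto
  have D: "a \<in> F" if "a \<in> persistent T F l u v" for a
    using that by (simp add: persistent_def)
  show ?thesis
  proof (cases "v - u \<le> T")
    case True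
    have "located T F' l' (u - c) (v - c) (x - c) \<longleftrightarrow>
        (\<exists>a. a \<in> F' \<and> v - c - T \<le> a \<and> a \<le> u - c \<and> l' a = x - c \<and> u - c \<le> x - c \<and> x - c \<le> v - c)"
      using True by (auto simp: located_def)
    also have "\<dots> \<longleftrightarrow> (\<exists>a. a \<in> F \<and> v - T \<le> a \<and> a \<le> u \<and> l a = x \<and> u \<le> x \<and> x \<le> v)"
      by (subst ex) (use F val in auto)
    finally show ?thesis using True by (auto simp: located_def)
  next
    case False
    let ?D = "persistent T F l u v" and ?D' = "persistent T F' l' (u - c) (v - c)"
    note shift = persistent_shift[OF F l w, of _ u v]
    have "located T F' l' (u - c) (v - c) (x - c) \<longleftrightarrow>
        (\<exists>s. s \<in> ?D' \<and> (\<forall>a. a \<in> ?D' \<longrightarrow> s \<le> a) \<and> l' s = x - c)"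
      using False by (auto simp: located_def)
    also have "\<dots> \<longleftrightarrow> (\<exists>s. s \<in> ?D \<and> (\<forall>a. a \<in> ?D \<longrightarrow> s \<le> a) \<and> l s = x)"
      by (subst ex, subst all) (use shift D val in auto)
    finally show ?thesis using False by (auto simp: located_def)
  qed
qed

lemma location_shift:
  assumes F: "\<And>a. a \<in> F \<longleftrightarrow> a - c \<in> F'" and l: "\<And>a. a \<in> F \<Longrightarrow> l a = l' (a - c) + c"
    and w: "sliding_window T F l" and w': "sliding_window T F' l'"
  shows "location T F l u v = location T F' l' (u - c) (v - c) + ereal c"
proof (cases "\<exists>x. located T F l u v x")
  case True
  then obtain x where x: "located T F l u v x" ..
  then have x': "located T F' l' (u - c) (v - c) (x - c)"
    using located_shift[OF F l w] by simp
  have "location T F l u v = ereal x"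
    using x sliding_window.location_eq_ereal_iff[OF w] by blast
  moreover have "location T F' l' (u - c) (v - c) = ereal (x - c)"
    using x' sliding_window.location_eq_ereal_iff[OF w'] by blast
  ultimately show ?thesis by simp
next
  case False
  then have "\<not> located T F' l' (u - c) (v - c) y" for y
    using located_shift[OF F l w, of u v "y + c"] by simp
  with False show ?thesis by (simp add: location_def)
qed

section \<open>From intrinsic to local functionals\<close>

lemma atLeastAtMost_in_compact_intervals: "a < b \<Longrightarrow> {a..b} \<in> compact_intervals"
  by (auto simp: compact_intervals_def)

lemma pre_intrinsicD:
  assumes L: "pre_intrinsic_location_functional H L" and f: "f \<in> H" and I: "I \<in> compact_intervals"
  shows "L f I \<in> ereal ` I \<union> {\<infinity>}"
    and "L f I = L (shift c f) ((\<lambda>x. x - c) ` I) + ereal c"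
    and "J \<in> compact_intervals \<Longrightarrow> J \<subseteq> I \<Longrightarrow> L f I \<in> ereal ` J \<Longrightarrow> L f J = L f I"
    and "J \<in> compact_intervals \<Longrightarrow> J \<subseteq> I \<Longrightarrow> L f J \<noteq> \<infinity> \<Longrightarrow> L f I \<noteq> \<infinity>"
proof -
  note L' = L[unfolded pre_intrinsic_location_functional_def]
  show "L f I \<in> ereal ` I \<union> {\<infinity>}"
    by (rule L'[THEN conjunct1, rule_format, OF f I])
  show "L f I = L (shift c f) ((\<lambda>x. x - c) ` I) + ereal c"
    by (rule L'[THEN conjunct2, THEN conjunct1, rule_format, OF f I])
  show "J \<in> compact_intervals \<Longrightarrow> J \<subseteq> I \<Longrightarrow> L f I \<in> ereal ` J \<Longrightarrow> L f J = L f I"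
    by (rule L'[THEN conjunct2, THEN conjunct2, THEN conjunct1, rule_format, OF f I])
  show "J \<in> compact_intervals \<Longrightarrow> J \<subseteq> I \<Longrightarrow> L f J \<noteq> \<infinity> \<Longrightarrow> L f I \<noteq> \<infinity>"
    by (rule L'[THEN conjunct2, THEN conjunct2, THEN conjunct2, rule_format, OF f I])
qed

lemma pre_intrinsic_imp_exchange:
  assumes L: "pre_intrinsic_location_functional H L" and f: "f \<in> H" and "0 < T"
    and b: "L f {a..a + T} \<in> ereal ` {b..b + T}"
  shows "L f {b..b + T} = L f {a..a + T} \<or> L f {b..b + T} \<in> ereal ` ({b..b + T} - {a..a + T})"
proof -
  let ?A = "{a..a + T}" and ?B = "{b..b + T}"
  define U where "U = {min a b..max a b + T}"
  have ci: "?A \<in> compact_intervals" "?B \<in> compact_intervals" "U \<in> compact_intervals"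
    using \<open>0 < T\<close> by (auto simp: U_def intro!: atLeastAtMost_in_compact_intervals)
  note range = pre_intrinsicD(1)[OF L f] and sub = pre_intrinsicD(3)[OF L f]
    and fin = pre_intrinsicD(4)[OF L f]
  have AU: "?A \<subseteq> U" and BU: "?B \<subseteq> U" by (auto simp: U_def)
  have "L f ?A \<noteq> \<infinity>" using b by auto
  then obtain x where x: "x \<in> ?A" "x \<in> ?B" "L f ?A = ereal x"
    using range[OF ci(1)] b by auto
  \<comment> \<open>The common point \<open>x\<close> leaves no gap between the two windows.\<close>
  have "U \<subseteq> ?A \<union> ?B" using x by (auto simp: U_def)
  moreover have "L f U \<in> ereal ` U"
    using range[OF ci(3)] fin[OF ci(3) ci(1) AU] x by auto
  ultimately consider "L f U \<in> ereal ` ?A" | "L f U \<in> ereal ` ?B" "L f U \<notin> ereal ` ?A"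
    by blast
  then show ?thesis
  proof cases
    \<comment> \<open>Here \<open>U\<close> and the first window share their value, which by
      assumption lies in the second window, so all three agree.\<close>
    case 1
    then have "L f U = L f ?A" using sub[OF ci(3) ci(1) AU] by simp
    then show ?thesis using sub[OF ci(3) ci(2) BU] b by simp
  next
    case 2
    then have "L f ?B = L f U" using sub[OF ci(3) ci(2) BU] by simp
    then show ?thesis using 2 by auto
  qed
qed

lemma intrinsic_imp_local_intrinsic:
  assumes "intrinsic_location_functional H L" "0 < T"
  shows "local_intrinsic_location_functional H T (\<lambda>f a. L f {a..a + T})"
proof -
  have L: "pre_intrinsic_location_functional H L"
    using assms(1) by (simp add: intrinsic_location_functional_def)
  have ci: "{a..a + T} \<in> compact_intervals" for a
    using assms(2) by (intro atLeastAtMost_in_compact_intervals) simp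
  have "(\<lambda>f. L f {a..a + T}) \<in> cylindrical H \<rightarrow>\<^sub>M real_infty" for a
    using assms(1) ci by (simp add: intrinsic_location_functional_def)
  moreover have "L f {a..a + T} \<in> ereal ` {a..a + T} \<union> {\<infinity>}" if "f \<in> H" for f a
    by (rule pre_intrinsicD(1)[OF L that ci])
  moreover have "L f {a..a + T} = L (shift c f) {a - c..a - c + T} + ereal c" if "f \<in> H" for f a c
  proof -
    have "(\<lambda>x. x - c) ` {a..a + T} = {a - c..a - c + T}"
      by (simp add: algebra_simps)
    then show ?thesis
      using pre_intrinsicD(2)[OF L that ci[of a], of c] by metis
  qed
  ultimately show ?thesis
    using assms(2) pre_intrinsic_imp_exchange[OF L]
    unfolding local_intrinsic_location_functional_def by simp
qed

section \<open>From local to pre-intrinsic functionals\<close>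

text \<open>The range condition excludes negative infinity, so \<open>real_of_ereal\<close> loses
  nothing on the given set; elsewhere its value is a dummy.\<close>

lemma local_intrinsic_imp_sliding_window:
  assumes L: "local_intrinsic_location_functional H T L\<^sub>T" and f: "f \<in> H"
  shows "sliding_window T {a. L\<^sub>T f a \<noteq> \<infinity>} (\<lambda>a. real_of_ereal (L\<^sub>T f a))"
proof
  show "0 < T" using L by (simp add: local_intrinsic_location_functional_def)
  have range: "L\<^sub>T f a \<in> ereal ` {a..a + T} \<union> {\<infinity>}" for a
    using L f unfolding local_intrinsic_location_functional_def by blast
  show "a \<le> real_of_ereal (L\<^sub>T f a) \<and> real_of_ereal (L\<^sub>T f a) \<le> a + T"
    if "a \<in> {a. L\<^sub>T f a \<noteq> \<infinity>}" for a
    using range[of a] that by auto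
  show "b \<in> {a. L\<^sub>T f a \<noteq> \<infinity>} \<and>
      (real_of_ereal (L\<^sub>T f b) = real_of_ereal (L\<^sub>T f a) \<or> real_of_ereal (L\<^sub>T f b) < a \<or>
       a + T < real_of_ereal (L\<^sub>T f b))"
    if "a \<in> {a. L\<^sub>T f a \<noteq> \<infinity>}" "b \<le> real_of_ereal (L\<^sub>T f a)" "real_of_ereal (L\<^sub>T f a) \<le> b + T" for a b
  proof -
    have "L\<^sub>T f a \<in> ereal ` {b..b + T}"
      using range[of a] that by auto
    then have "L\<^sub>T f b = L\<^sub>T f a \<or> L\<^sub>T f b \<in> ereal ` ({b..b + T} - {a..a + T})"
      using L f unfolding local_intrinsic_location_functional_def by blast
    then show ?thesis using that by auto
  qed
qed

lemma local_intrinsic_extends: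
  assumes H: "closed_under_shifts H" and L: "local_intrinsic_location_functional H T L\<^sub>T"
  shows "\<exists>L. pre_intrinsic_location_functional H L \<and> (\<forall>f\<in>H. \<forall>a. L\<^sub>T f a = L f {a..a + T})"
proof -
  define F where "F f = {a. L\<^sub>T f a \<noteq> \<infinity>}" for f
  define l where "l f a = real_of_ereal (L\<^sub>T f a)" for f a
  \<comment> \<open>On a compact interval \<open>Inf\<close> and \<open>Sup\<close> are the
    endpoints.\<close>
  define L where "L f I = location T (F f) (l f) (Inf I) (Sup I)" for f I
  have w: "sliding_window T (F f) (l f)" if "f \<in> H" for f
    using local_intrinsic_imp_sliding_window[OF L that] by (simp add: F_def l_def[abs_def])
  have T: "0 < T"
    using L by (simp add: local_intrinsic_location_functional_def)
  have L_Icc: "L f {u..v} = location T (F f) (l f) u v" if "u < v" for f u v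
    using that by (simp add: L_def)
  have LT: "L\<^sub>T f a = (if a \<in> F f then ereal (l f a) else \<infinity>)" if "f \<in> H" for f a
  proof -
    have "L\<^sub>T f a \<in> ereal ` {a..a + T} \<union> {\<infinity>}"
      using L that unfolding local_intrinsic_location_functional_def by blast
    then show ?thesis by (auto simp: F_def l_def)
  qed
  have shift_LT: "L\<^sub>T f a = L\<^sub>T (shift c f) (a - c) + ereal c" if "f \<in> H" for f a c
    using L that unfolding local_intrinsic_location_functional_def by blast
  have range: "L f {u..v} \<in> ereal ` {u..v} \<union> {\<infinity>}" if h: "f \<in> H" "u < v" for f u v
  proof (cases "L f {u..v} = \<infinity>")
    case False
    then obtain x where x: "located T (F f) (l f) u v x"
      using h(2) location_neq_infinity_iff[of T "F f" "l f" u v] by (auto simp: L_Icc)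
    moreover from x have "L f {u..v} = ereal x"
      using h w sliding_window.location_eq_ereal_iff L_Icc by metis
    ultimately show ?thesis
      using sliding_window.located_in_interval(1,2)[OF w[OF h(1)]] by auto
  qed simp
  have shift: "L f {u..v} = L (shift c f) ((\<lambda>x. x - c) ` {u..v}) + ereal c"
    if "f \<in> H" "u < v" for f u v c
  proof -
    have sH: "shift c f \<in> H"
      using H that by (simp add: closed_under_shifts_def)
    have "a \<in> F f \<longleftrightarrow> a - c \<in> F (shift c f)" for a
      using shift_LT[OF that(1), of a c] by (cases "L\<^sub>T (shift c f) (a - c)") (auto simp: F_def)
    moreover have "l f a = l (shift c f) (a - c) + c" if "a \<in> F f" for a
      using shift_LT[OF \<open>f \<in> H\<close>, of a c] LT[OF \<open>f \<in> H\<close>, of a] LT[OF sH, of "a - c"] that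
      by (auto split: if_splits)
    ultimately have "location T (F f) (l f) u v =
        location T (F (shift c f)) (l (shift c f)) (u - c) (v - c) + ereal c"
      by (intro location_shift w that sH)
    then show ?thesis using that by (simp add: L_Icc)
  qed
  have sub: "L f {u'..v'} = L f {u..v}"
    if h: "f \<in> H" "u < v" "u' < v'" "{u'..v'} \<subseteq> {u..v}" "L f {u..v} \<in> ereal ` {u'..v'}" for f u v u' v'
  proof -
    obtain x where x: "u' \<le> x" "x \<le> v'" "L f {u..v} = ereal x"
      using h(5) by auto
    then have "located T (F f) (l f) u v x"
      using h w sliding_window.location_eq_ereal_iff L_Icc by metis
    then have "located T (F f) (l f) u' v' x"
      using sliding_window.located_subinterval[OF w[OF h(1)], of u u' v' v x] h x by auto
    then show ?thesis
      using h w x sliding_window.location_eq_ereal_iff L_Icc by metis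
  qed
  have fin: "L f {u..v} \<noteq> \<infinity>"
    if h: "f \<in> H" "u < v" "u' < v'" "{u'..v'} \<subseteq> {u..v}" "L f {u'..v'} \<noteq> \<infinity>" for f u v u' v'
  proof -
    interpret sliding_window T "F f" "l f" by (rule w[OF h(1)])
    obtain x where x: "located T (F f) (l f) u' v' x"
      using h(3,5) location_neq_infinity_iff[of T "F f" "l f" u' v'] by (auto simp: L_Icc)
    \<comment> \<open>A value on the small interval is the location of some window and also lies in
      the large interval.\<close>
    obtain a where "a \<in> F f" "l f a = x"
      using located_in_interval(3)[OF x] by blast
    then have "\<exists>y. located T (F f) (l f) u v y"
      using located_in_interval(1,2)[OF x] h by (intro located_exists) auto
    then show ?thesis
      using h by (simp add: L_Icc location_neq_infinity_iff)
  qed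
  have "pre_intrinsic_location_functional H L"
    unfolding pre_intrinsic_location_functional_def
  proof (intro conjI ballI allI impI)
    fix f I assume "f \<in> H" "I \<in> compact_intervals"
    then show "L f I \<in> ereal ` I \<union> {\<infinity>}"
      using range by (auto simp: compact_intervals_def simp del: image_iff)
  next
    fix f I c assume "f \<in> H" "I \<in> compact_intervals"
    then show "L f I = L (shift c f) ((\<lambda>x. x - c) ` I) + ereal c"
      using shift unfolding compact_intervals_def by blast
  next
    fix f I J assume "f \<in> H" "I \<in> compact_intervals" "J \<in> compact_intervals"
      "J \<subseteq> I" "L f I \<in> ereal ` J"
    then show "L f J = L f I"
      using sub unfolding compact_intervals_def by blast
  next
    fix f I J assume "f \<in> H" "I \<in> compact_intervals" "J \<in> compact_intervals"
      "J \<subseteq> I" "L f J \<noteq> \<infinity>"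
    then show "L f I \<noteq> \<infinity>"
      using fin unfolding compact_intervals_def by blast
  qed
  moreover have "L\<^sub>T f a = L f {a..a + T}" if "f \<in> H" for f a
    using LT[OF that] sliding_window.location_window[OF w[OF that]] L_Icc T by simp
  ultimately show ?thesis by blast
qed

theorem theorem4p1:
  fixes H :: "(real \<Rightarrow> real) set"
  assumes "closed_under_shifts H"
  shows "(\<forall>L :: (real \<Rightarrow> real) \<Rightarrow> real set \<Rightarrow> ereal.
            intrinsic_location_functional H L \<longrightarrow>
            (\<forall>T>0. local_intrinsic_location_functional H T (\<lambda>f a. L f {a..a + T}))) \<and>
         (\<forall>T>0. \<forall>L\<^sub>T :: (real \<Rightarrow> real) \<Rightarrow> real \<Rightarrow> ereal.
            local_intrinsic_location_functional H T L\<^sub>T \<longrightarrow>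
            (\<exists>L. pre_intrinsic_location_functional H L \<and>
                 (\<forall>f\<in>H. \<forall>a. L\<^sub>T f a = L f {a..a + T})))"
  by (intro conjI allI impI; rule intrinsic_imp_local_intrinsic local_intrinsic_extends[OF assms];
      assumption)

end
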